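(* Let $R$ be a (commutative) Noetherian ring and let $I$ be a proper ideal of $R$. Assume that $I$ has no embedded primes, i.e. $\operatorname{Ass}(R/I)=\operatorname{Min}(I)$. Let $t\ge 1$ be an integer. Then: (1) $I^t = I^{(t)}$ if and only if $I^t$ has no embedded primes. (2) $\operatorname{Ass}(M_t) = \operatorname{Emb}_t(I)$, where $M_t = I^{(t)}/I^t$.
   Context: For an ideal $I$ of a Noetherian ring $R$ and $t\ge 1$, the $t$-th symbolic power is $I^{(t)}=\left(\bigcap_{P\in \operatorname{Ass}(R/I)} I^tR_P\right)\cap R$, i.e. the set of $r\in R$ whose image in $R_P$ lies in $I^tR_P$ for every $P\in\operatorname{Ass}(R/I)$. $\operatorname{Min}(I)$ is the set of minimal primes of $I$. $\operatorname{Emb}_t(I)=\operatorname{Ass}(R/I^t)\setminus \operatorname{Min}(I)$ is the set of embedded primes of $I^t$. The discrepancy module is $M_t=I^{(t)}/I^t$. *)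

theory Defs
  imports "HOL-Algebra.Algebra"
begin

section \<open>Localization\<close>

text \<open>
  Fractions are equivalence classes of pairs (numerator, denominator); the extra factor \<open>u\<close>
  is needed because \<open>S\<close> may contain zero divisors.
\<close>

definition frac_rel :: "('a, 'b) ring_scheme \<Rightarrow> 'a set \<Rightarrow> (('a \<times> 'a) \<times> ('a \<times> 'a)) set" where
  "frac_rel R S = {((r, s), (r', s')). r \<in> carrier R \<and> s \<in> S \<and> r' \<in> carrier R \<and> s' \<in> S \<and>
     (\<exists>u \<in> S. u \<otimes>\<^bsub>R\<^esub> (s' \<otimes>\<^bsub>R\<^esub> r) = u \<otimes>\<^bsub>R\<^esub> (s \<otimes>\<^bsub>R\<^esub> r'))}"

definition fraction :: "('a, 'b) ring_scheme \<Rightarrow> 'a set \<Rightarrow> 'a \<Rightarrow> 'a \<Rightarrow> ('a \<times> 'a) set" where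
  "fraction R S r s = frac_rel R S `` {(r, s)}"

text \<open>
  As for \<^const>\<open>FactRing\<close>, the operations on classes are unions over all representatives;
  \<open>frac_add\<close> and \<open>frac_mult\<close> below show that they do not depend on the representatives.
\<close>

definition fraction_mult ::
    "('a, 'b) ring_scheme \<Rightarrow> 'a set \<Rightarrow> ('a \<times> 'a) set \<Rightarrow> ('a \<times> 'a) set \<Rightarrow> ('a \<times> 'a) set" where
  "fraction_mult R S A B =
     (\<Union>(r, s) \<in> A. \<Union>(r', s') \<in> B. fraction R S (r \<otimes>\<^bsub>R\<^esub> r') (s \<otimes>\<^bsub>R\<^esub> s'))"

definition fraction_add ::
    "('a, 'b) ring_scheme \<Rightarrow> 'a set \<Rightarrow> ('a \<times> 'a) set \<Rightarrow> ('a \<times> 'a) set \<Rightarrow> ('a \<times> 'a) set" where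
  "fraction_add R S A B =
     (\<Union>(r, s) \<in> A. \<Union>(r', s') \<in> B.
       fraction R S ((s' \<otimes>\<^bsub>R\<^esub> r) \<oplus>\<^bsub>R\<^esub> (s \<otimes>\<^bsub>R\<^esub> r')) (s \<otimes>\<^bsub>R\<^esub> s'))"

definition localization :: "('a, 'b) ring_scheme \<Rightarrow> 'a set \<Rightarrow> ('a \<times> 'a) set ring" where
  "localization R S =
     \<lparr>carrier = (carrier R \<times> S) // frac_rel R S,
      monoid.mult = fraction_mult R S, monoid.one = fraction R S \<one>\<^bsub>R\<^esub> \<one>\<^bsub>R\<^esub>,
      ring.zero = fraction R S \<zero>\<^bsub>R\<^esub> \<one>\<^bsub>R\<^esub>, ring.add = fraction_add R S\<rparr>"

definition loc_at :: "('a, 'b) ring_scheme \<Rightarrow> 'a set \<Rightarrow> ('a \<times> 'a) set ring" where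
  "loc_at R P = localization R (carrier R - P)"

definition to_loc_at :: "('a, 'b) ring_scheme \<Rightarrow> 'a set \<Rightarrow> 'a \<Rightarrow> ('a \<times> 'a) set" where
  "to_loc_at R P r = fraction R (carrier R - P) r \<one>\<^bsub>R\<^esub>"

text \<open>The extension \<open>J R\<^sub>P\<close> of an ideal \<open>J\<close> of \<open>R\<close>.\<close>

definition ext_loc_at :: "('a, 'b) ring_scheme \<Rightarrow> 'a set \<Rightarrow> 'a set \<Rightarrow> ('a \<times> 'a) set set" where
  "ext_loc_at R P J = Idl\<^bsub>loc_at R P\<^esub> (to_loc_at R P ` J)"


section \<open>Quotient modules and associated primes\<close>

definition self_module :: "('a, 'b) ring_scheme \<Rightarrow> ('a, 'a) module" where
  "self_module R = \<lparr>carrier = carrier R, monoid.mult = (\<otimes>\<^bsub>R\<^esub>), monoid.one = \<one>\<^bsub>R\<^esub>,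
     ring.zero = \<zero>\<^bsub>R\<^esub>, ring.add = (\<oplus>\<^bsub>R\<^esub>), module.smult = (\<otimes>\<^bsub>R\<^esub>)\<rparr>"

text \<open>
  The type of modules extends that of rings, so the fields \<open>mult\<close> and \<open>one\<close> have to be filled;
  they play no role for modules.
\<close>

definition quot_module :: "('a, 'c, 'm) module_scheme \<Rightarrow> 'c set \<Rightarrow> ('a, 'c set) module" where
  "quot_module M N = \<lparr>carrier = a_rcosets\<^bsub>M\<^esub> N, monoid.mult = undefined,
     monoid.one = undefined, ring.zero = N, ring.add = set_add M,
     module.smult = (\<lambda>r A. \<Union>x \<in> A. N +>\<^bsub>M\<^esub> (r \<odot>\<^bsub>M\<^esub> x))\<rparr>"

text \<open>The module \<open>J/K\<close> for ideals \<open>K \<subseteq> J\<close>.\<close>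

definition ideal_quot :: "('a, 'b) ring_scheme \<Rightarrow> 'a set \<Rightarrow> 'a set \<Rightarrow> ('a, 'a set) module" where
  "ideal_quot R J K = quot_module ((self_module R)\<lparr>carrier := J\<rparr>) K"

definition annihilator :: "('a, 'b) ring_scheme \<Rightarrow> ('a, 'c, 'm) module_scheme \<Rightarrow> 'c \<Rightarrow> 'a set" where
  "annihilator R M x = {r \<in> carrier R. r \<odot>\<^bsub>M\<^esub> x = \<zero>\<^bsub>M\<^esub>}"

definition Ass :: "('a, 'b) ring_scheme \<Rightarrow> ('a, 'c, 'm) module_scheme \<Rightarrow> 'a set set" where
  "Ass R M = {P. primeideal P R \<and> (\<exists>x \<in> carrier M. P = annihilator R M x)}"

definition Min_primes :: "('a, 'b) ring_scheme \<Rightarrow> 'a set \<Rightarrow> 'a set set" where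
  "Min_primes R I = {P. primeideal P R \<and> I \<subseteq> P \<and>
     (\<forall>Q. primeideal Q R \<and> I \<subseteq> Q \<and> Q \<subseteq> P \<longrightarrow> Q = P)}"

definition no_embedded_primes :: "('a, 'b) ring_scheme \<Rightarrow> 'a set \<Rightarrow> bool" where
  "no_embedded_primes R I \<longleftrightarrow> Ass R (ideal_quot R (carrier R) I) = Min_primes R I"


section \<open>Powers, symbolic powers and the discrepancy module\<close>

definition ideal_power :: "('a, 'b) ring_scheme \<Rightarrow> 'a set \<Rightarrow> nat \<Rightarrow> 'a set" where
  "ideal_power R I t = I [^]\<^bsub>ideals_set R\<^esub> t"

text \<open>
  The preimage in \<open>R\<close> of \<open>I\<^sup>t R\<^sub>P\<close>, intersected over all \<open>P \<in> Ass(R/I)\<close>.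
\<close>

definition symbolic_power :: "('a, 'b) ring_scheme \<Rightarrow> 'a set \<Rightarrow> nat \<Rightarrow> 'a set" where
  "symbolic_power R I t = {r \<in> carrier R. \<forall>P \<in> Ass R (ideal_quot R (carrier R) I).
     to_loc_at R P r \<in> ext_loc_at R P (ideal_power R I t)}"

definition Emb :: "('a, 'b) ring_scheme \<Rightarrow> 'a set \<Rightarrow> nat \<Rightarrow> 'a set set" where
  "Emb R I t = Ass R (ideal_quot R (carrier R) (ideal_power R I t)) - Min_primes R I"

definition discrepancy_module :: "('a, 'b) ring_scheme \<Rightarrow> 'a set \<Rightarrow> nat \<Rightarrow> ('a, 'a set) module" where
  "discrepancy_module R I t = ideal_quot R (symbolic_power R I t) (ideal_power R I t)"


section \<open>Well-definedness of the constructions\<close>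

context cring
begin

lemma ideal_power_0: "ideal_power R I 0 = carrier R"
  by (simp add: ideal_power_def nat_pow_def ideals_set_def)

lemma ideal_power_Suc: "ideal_power R I (Suc t) = ideal_power R I t \<cdot> I"
  by (simp add: ideal_power_def nat_pow_def ideals_set_def)

lemma ideal_power_ideal: "ideal I R \<Longrightarrow> ideal (ideal_power R I t) R"
  by (induction t) (simp_all add: ideal_power_0 ideal_power_Suc oneideal ideal_prod_is_ideal)

lemma self_module_is_module: "module R (self_module R)"
proof (rule moduleI)
  show "cring R" by (rule is_cring)
  show "abelian_group (self_module R)"
    by (rule abelian_groupI) (auto simp: self_module_def a_ac intro: l_neg minus_closed
        intro!: bexI[of _ "\<ominus> _"])
qed (auto simp: self_module_def l_distr r_distr m_assoc)

end

locale cring_frac = cring R + submonoid S R for R (structure) and S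
begin

lemma S_carr: "s \<in> S \<Longrightarrow> s \<in> carrier R"
  using subset by auto

lemma frac_relI:
  assumes "r \<in> carrier R" "s \<in> S" "r' \<in> carrier R" "s' \<in> S" "u \<in> S"
    "u \<otimes> (s' \<otimes> r) = u \<otimes> (s \<otimes> r')"
  shows "((r, s), (r', s')) \<in> frac_rel R S"
  using assms by (auto simp: frac_rel_def)

lemma equiv_frac_rel: "equiv (carrier R \<times> S) (frac_rel R S)"
proof (rule equivI)
  show "frac_rel R S \<subseteq> (carrier R \<times> S) \<times> (carrier R \<times> S)"
    by (auto simp: frac_rel_def)
  show "refl_on (carrier R \<times> S) (frac_rel R S)"
    by (auto simp: refl_on_def frac_rel_def)
  show "sym (frac_rel R S)"
    by (rule symI) (auto simp: frac_rel_def, metis)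
  show "trans (frac_rel R S)"
  proof (rule transI)
    fix x y z
    assume xy: "(x, y) \<in> frac_rel R S" and yz: "(y, z) \<in> frac_rel R S"
    obtain a s b t c w where x: "x = (a, s)" "y = (b, t)" "z = (c, w)"
      by (metis prod.exhaust)
    from xy obtain u where u: "u \<in> S" "u \<otimes> (t \<otimes> a) = u \<otimes> (s \<otimes> b)"
      and c1: "a \<in> carrier R" "s \<in> S" "b \<in> carrier R" "t \<in> S"
      by (auto simp: x frac_rel_def)
    from yz obtain v where v: "v \<in> S" "v \<otimes> (w \<otimes> b) = v \<otimes> (t \<otimes> c)"
      and c2: "c \<in> carrier R" "w \<in> S"
      by (auto simp: x frac_rel_def)
    note cs = c1 c2 u(1) v(1) c1(2,4)[THEN S_carr] c2(2)[THEN S_carr] u(1)[THEN S_carr]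
      v(1)[THEN S_carr]
    have "(u \<otimes> v \<otimes> t) \<otimes> (w \<otimes> a) = (v \<otimes> w) \<otimes> (u \<otimes> (t \<otimes> a))"
      using cs by (simp add: m_ac)
    also have "\<dots> = (u \<otimes> s) \<otimes> (v \<otimes> (w \<otimes> b))"
      unfolding u(2) using cs by (simp add: m_ac)
    also have "\<dots> = (u \<otimes> v \<otimes> t) \<otimes> (s \<otimes> c)"
      unfolding v(2) using cs by (simp add: m_ac)
    finally show "(x, z) \<in> frac_rel R S"
      unfolding x using cs by (intro frac_relI[of _ _ _ _ "u \<otimes> v \<otimes> t"]) auto
  qed
qed

lemma frac_eq_iff:
  assumes "r \<in> carrier R" "s \<in> S" "r' \<in> carrier R" "s' \<in> S"
  shows "fraction R S r s = fraction R S r' s' \<longleftrightarrow> (\<exists>u \<in> S. u \<otimes> (s' \<otimes> r) = u \<otimes> (s \<otimes> r'))"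
proof -
  have "fraction R S r s = fraction R S r' s' \<longleftrightarrow> ((r, s), (r', s')) \<in> frac_rel R S"
    unfolding fraction_def using assms eq_equiv_class_iff[OF equiv_frac_rel] by simp
  thus ?thesis
    using assms by (simp add: frac_rel_def)
qed

lemma frac_self: "r \<in> carrier R \<Longrightarrow> s \<in> S \<Longrightarrow> (r, s) \<in> fraction R S r s"
  unfolding fraction_def by (rule equiv_class_self[OF equiv_frac_rel]) auto

lemma frac_memD:
  assumes "(r', s') \<in> fraction R S r s"
  shows "r' \<in> carrier R" "s' \<in> S" "fraction R S r' s' = fraction R S r s"
proof -
  have rel: "((r, s), (r', s')) \<in> frac_rel R S"
    using assms by (simp add: fraction_def)
  show "r' \<in> carrier R" "s' \<in> S"
    using rel by (simp_all add: frac_rel_def)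
  show "fraction R S r' s' = fraction R S r s"
    using equiv_class_eq[OF equiv_frac_rel rel] by (simp add: fraction_def)
qed

lemma loc_carrier: "carrier (localization R S) = {fraction R S r s | r s. r \<in> carrier R \<and> s \<in> S}"
  by (auto simp: localization_def fraction_def quotient_def)

lemma frac_closed: "r \<in> carrier R \<Longrightarrow> s \<in> S \<Longrightarrow> fraction R S r s \<in> carrier (localization R S)"
  by (auto simp: loc_carrier)

lemma frac_mult_cong:
  assumes "(a', s') \<in> fraction R S a s" "(b', t') \<in> fraction R S b t"
    and "a \<in> carrier R" "s \<in> S" "b \<in> carrier R" "t \<in> S"
  shows "fraction R S (a' \<otimes> b') (s' \<otimes> t') = fraction R S (a \<otimes> b) (s \<otimes> t)"
proof -
  note m = frac_memD[OF assms(1)] frac_memD[OF assms(2)]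
  obtain u where u: "u \<in> S" "u \<otimes> (s \<otimes> a') = u \<otimes> (s' \<otimes> a)"
    using m assms frac_eq_iff[of a' s' a s] by auto
  obtain v where v: "v \<in> S" "v \<otimes> (t \<otimes> b') = v \<otimes> (t' \<otimes> b)"
    using m assms frac_eq_iff[of b' t' b t] by auto
  note cs = u(1) v(1) m(1,2,4,5) assms(3-6) S_carr
  have "(u \<otimes> v) \<otimes> ((s \<otimes> t) \<otimes> (a' \<otimes> b')) = (u \<otimes> (s \<otimes> a')) \<otimes> (v \<otimes> (t \<otimes> b'))"
    using cs by (simp add: m_ac)
  also have "\<dots> = (u \<otimes> v) \<otimes> ((s' \<otimes> t') \<otimes> (a \<otimes> b))"
    unfolding u(2) v(2) using cs by (simp add: m_ac)
  finally show ?thesis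
    using cs by (subst frac_eq_iff) (auto intro!: bexI[of _ "u \<otimes> v"])
qed

lemma frac_add_cong:
  assumes "(a', s') \<in> fraction R S a s" "(b', t') \<in> fraction R S b t"
    and "a \<in> carrier R" "s \<in> S" "b \<in> carrier R" "t \<in> S"
  shows "fraction R S ((t' \<otimes> a') \<oplus> (s' \<otimes> b')) (s' \<otimes> t') = fraction R S ((t \<otimes> a) \<oplus> (s \<otimes> b)) (s \<otimes> t)"
proof -
  note m = frac_memD[OF assms(1)] frac_memD[OF assms(2)]
  obtain u where u: "u \<in> S" "u \<otimes> (s \<otimes> a') = u \<otimes> (s' \<otimes> a)"
    using m assms frac_eq_iff[of a' s' a s] by auto
  obtain v where v: "v \<in> S" "v \<otimes> (t \<otimes> b') = v \<otimes> (t' \<otimes> b)"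
    using m assms frac_eq_iff[of b' t' b t] by auto
  note cs = u(1) v(1) m(1,2,4,5) assms(3-6) S_carr
  have "(u \<otimes> v) \<otimes> ((s \<otimes> t) \<otimes> ((t' \<otimes> a') \<oplus> (s' \<otimes> b')))
      = (v \<otimes> t \<otimes> t') \<otimes> (u \<otimes> (s \<otimes> a')) \<oplus> (u \<otimes> s \<otimes> s') \<otimes> (v \<otimes> (t \<otimes> b'))"
    using cs by (simp add: r_distr m_ac)
  also have "\<dots> = (u \<otimes> v) \<otimes> ((s' \<otimes> t') \<otimes> ((t \<otimes> a) \<oplus> (s \<otimes> b)))"
    unfolding u(2) v(2) using cs by (simp add: r_distr m_ac)
  finally show ?thesis
    using cs by (subst frac_eq_iff) (auto intro!: bexI[of _ "u \<otimes> v"])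
qed

lemma frac_mult:
  assumes "a \<in> carrier R" "s \<in> S" "b \<in> carrier R" "t \<in> S"
  shows "fraction R S a s \<otimes>\<^bsub>localization R S\<^esub> fraction R S b t = fraction R S (a \<otimes> b) (s \<otimes> t)"
proof -
  have "fraction R S a s \<otimes>\<^bsub>localization R S\<^esub> fraction R S b t =
      (\<Union>(r, s) \<in> fraction R S a s. \<Union>(r', s') \<in> fraction R S b t. fraction R S (r \<otimes> r') (s \<otimes> s'))"
    by (simp add: localization_def fraction_mult_def fraction_add_def)
  also have "\<dots> = (\<Union>x \<in> fraction R S a s. \<Union>y \<in> fraction R S b t. fraction R S (a \<otimes> b) (s \<otimes> t))"
    using frac_mult_cong[OF _ _ assms] by (intro SUP_cong refl) auto
  also have "\<dots> = fraction R S (a \<otimes> b) (s \<otimes> t)"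
    using frac_self[of a s] frac_self[of b t] assms by auto
  finally show ?thesis .
qed

lemma frac_add:
  assumes "a \<in> carrier R" "s \<in> S" "b \<in> carrier R" "t \<in> S"
  shows "fraction R S a s \<oplus>\<^bsub>localization R S\<^esub> fraction R S b t = fraction R S ((t \<otimes> a) \<oplus> (s \<otimes> b)) (s \<otimes> t)"
proof -
  have "fraction R S a s \<oplus>\<^bsub>localization R S\<^esub> fraction R S b t =
      (\<Union>(r, s) \<in> fraction R S a s. \<Union>(r', s') \<in> fraction R S b t.
        fraction R S ((s' \<otimes> r) \<oplus> (s \<otimes> r')) (s \<otimes> s'))"
    by (simp add: localization_def fraction_mult_def fraction_add_def)
  also have "\<dots> = (\<Union>x \<in> fraction R S a s. \<Union>y \<in> fraction R S b t. fraction R S ((t \<otimes> a) \<oplus> (s \<otimes> b)) (s \<otimes> t))"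
    using frac_add_cong[OF _ _ assms] by (intro SUP_cong refl) auto
  also have "\<dots> = fraction R S ((t \<otimes> a) \<oplus> (s \<otimes> b)) (s \<otimes> t)"
    using frac_self[of a s] frac_self[of b t] assms by auto
  finally show ?thesis .
qed

lemma loc_one: "\<one>\<^bsub>localization R S\<^esub> = fraction R S \<one> \<one>"
  and loc_zero: "\<zero>\<^bsub>localization R S\<^esub> = fraction R S \<zero> \<one>"
  by (simp_all add: localization_def)

lemma frac_eqI:
  assumes "r \<in> carrier R" "s \<in> S" "r' \<in> carrier R" "s' \<in> S" "s' \<otimes> r = s \<otimes> r'"
  shows "fraction R S r s = fraction R S r' s'"
  using assms by (subst frac_eq_iff) auto

lemma loc_cases:
  assumes "x \<in> carrier (localization R S)"
  obtains a s where "x = fraction R S a s" "a \<in> carrier R" "s \<in> S" "s \<in> carrier R"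
  using assms S_carr by (auto simp: loc_carrier)

lemma localization_cring: "cring (localization R S)"
proof (rule cringI)
  let ?L = "localization R S"
  show "abelian_group ?L"
  proof (rule abelian_groupI)
    fix x assume "x \<in> carrier ?L"
    then obtain a s where x: "x = fraction R S a s" "a \<in> carrier R" "s \<in> S" "s \<in> carrier R"
      by (rule loc_cases)
    have "fraction R S (s \<otimes> \<ominus> a \<oplus> s \<otimes> a) (s \<otimes> s) = fraction R S \<zero> \<one>"
      using x by (intro frac_eqI) (auto simp: r_minus l_neg)
    hence "fraction R S (\<ominus> a) s \<oplus>\<^bsub>?L\<^esub> x = \<zero>\<^bsub>?L\<^esub>"
      using x by (simp add: frac_add loc_zero)
    thus "\<exists>y \<in> carrier ?L. y \<oplus>\<^bsub>?L\<^esub> x = \<zero>\<^bsub>?L\<^esub>"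
      using x frac_closed[of "\<ominus> a" s] by blast
    have "fraction R S (s \<otimes> \<zero> \<oplus> \<one> \<otimes> a) (\<one> \<otimes> s) = fraction R S a s"
      using x by simp
    thus "\<zero>\<^bsub>?L\<^esub> \<oplus>\<^bsub>?L\<^esub> x = x"
      using x by (simp add: frac_add loc_zero)
    fix y assume "y \<in> carrier ?L"
    then obtain b t where y: "y = fraction R S b t" "b \<in> carrier R" "t \<in> S" "t \<in> carrier R"
      by (rule loc_cases)
    show "x \<oplus>\<^bsub>?L\<^esub> y \<in> carrier ?L"
      using x y by (simp add: frac_add frac_closed)
    show "x \<oplus>\<^bsub>?L\<^esub> y = y \<oplus>\<^bsub>?L\<^esub> x"
      using x y by (simp add: frac_add a_comm m_comm)
    fix z assume "z \<in> carrier ?L"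
    then obtain c w where z: "z = fraction R S c w" "c \<in> carrier R" "w \<in> S" "w \<in> carrier R"
      by (rule loc_cases)
    show "x \<oplus>\<^bsub>?L\<^esub> y \<oplus>\<^bsub>?L\<^esub> z = x \<oplus>\<^bsub>?L\<^esub> (y \<oplus>\<^bsub>?L\<^esub> z)"
      using x y z by (simp add: frac_add r_distr a_ac m_ac)
  next
    show "\<zero>\<^bsub>?L\<^esub> \<in> carrier ?L"
      by (simp add: loc_zero frac_closed)
  qed
  show "comm_monoid ?L"
  proof (rule comm_monoidI)
    fix x y z assume "x \<in> carrier ?L" "y \<in> carrier ?L" "z \<in> carrier ?L"
    then show "x \<otimes>\<^bsub>?L\<^esub> y \<otimes>\<^bsub>?L\<^esub> z = x \<otimes>\<^bsub>?L\<^esub> (y \<otimes>\<^bsub>?L\<^esub> z)"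
      by (elim loc_cases) (simp add: frac_mult m_assoc)
  next
    fix x y assume "x \<in> carrier ?L" "y \<in> carrier ?L"
    then show "x \<otimes>\<^bsub>?L\<^esub> y \<in> carrier ?L" "x \<otimes>\<^bsub>?L\<^esub> y = y \<otimes>\<^bsub>?L\<^esub> x"
      by (elim loc_cases, simp add: frac_mult frac_closed m_comm)+
  next
    fix x assume "x \<in> carrier ?L"
    then show "\<one>\<^bsub>?L\<^esub> \<otimes>\<^bsub>?L\<^esub> x = x"
      by (elim loc_cases) (simp add: frac_mult loc_one)
  next
    show "\<one>\<^bsub>?L\<^esub> \<in> carrier ?L"
      by (simp add: loc_one frac_closed)
  qed
  fix x y z
  assume x': "x \<in> carrier ?L" and y': "y \<in> carrier ?L" and z': "z \<in> carrier ?L"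
  obtain a s where x: "x = fraction R S a s" "a \<in> carrier R" "s \<in> S" "s \<in> carrier R"
    using x' by (rule loc_cases)
  obtain b t where y: "y = fraction R S b t" "b \<in> carrier R" "t \<in> S" "t \<in> carrier R"
    using y' by (rule loc_cases)
  obtain c w where z: "z = fraction R S c w" "c \<in> carrier R" "w \<in> S" "w \<in> carrier R"
    using z' by (rule loc_cases)
  have "fraction R S ((t \<otimes> a \<oplus> s \<otimes> b) \<otimes> c) (s \<otimes> t \<otimes> w) =
      fraction R S ((t \<otimes> w) \<otimes> (a \<otimes> c) \<oplus> (s \<otimes> w) \<otimes> (b \<otimes> c)) (s \<otimes> w \<otimes> (t \<otimes> w))"
    using x y z by (intro frac_eqI) (auto simp: l_distr r_distr m_ac)
  thus "(x \<oplus>\<^bsub>?L\<^esub> y) \<otimes>\<^bsub>?L\<^esub> z = x \<otimes>\<^bsub>?L\<^esub> z \<oplus>\<^bsub>?L\<^esub> y \<otimes>\<^bsub>?L\<^esub> z"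
    using x y z by (simp add: frac_add frac_mult)
qed

lemma frac_hom: "(\<lambda>r. fraction R S r \<one>) \<in> ring_hom R (localization R S)"
  by (rule ring_hom_memI) (auto simp: frac_closed frac_mult frac_add loc_one)

end

lemma (in primeideal) cring_frac_compl: "cring_frac R (carrier R - I)"
proof -
  have "\<one> \<notin> I"
    using I_notcarr one_imp_carrier by auto
  moreover have "x \<otimes> y \<in> carrier R - I" if "x \<in> carrier R - I" "y \<in> carrier R - I" for x y
    using that I_prime by auto
  ultimately show ?thesis
    by (auto intro!: cring_frac.intro submonoid.intro is_cring)
qed

lemma (in primeideal) loc_at_cring: "cring (loc_at R I)"
  and to_loc_at_hom: "to_loc_at R I \<in> ring_hom R (loc_at R I)"
proof -
  interpret F: cring_frac R "carrier R - I"
    by (rule cring_frac_compl)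
  show "cring (loc_at R I)"
    by (simp add: loc_at_def F.localization_cring)
  show "to_loc_at R I \<in> ring_hom R (loc_at R I)"
    using F.frac_hom by (simp add: loc_at_def to_loc_at_def[abs_def])
qed

lemma (in module) abelian_subgroup_submodule:
  assumes "submodule N R M"
  shows "abelian_subgroup N M"
  using assms M.abelian_group_axioms
  by (intro abelian_subgroupI3 additive_subgroup.intro) (simp_all add: submodule_def)

lemma (in module) quot_smult:
  assumes N: "submodule N R M" and r: "r \<in> carrier R" and x: "x \<in> carrier M"
  shows "r \<odot>\<^bsub>quot_module M N\<^esub> (N +>\<^bsub>M\<^esub> x) = N +>\<^bsub>M\<^esub> (r \<odot>\<^bsub>M\<^esub> x)"
proof -
  interpret N: abelian_subgroup N M
    by (rule abelian_subgroup_submodule[OF N])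
  have eq: "N +>\<^bsub>M\<^esub> (r \<odot>\<^bsub>M\<^esub> y) = N +>\<^bsub>M\<^esub> (r \<odot>\<^bsub>M\<^esub> x)" if y: "y \<in> N +>\<^bsub>M\<^esub> x" for y
  proof -
    obtain n where n: "n \<in> N" "y = n \<oplus>\<^bsub>M\<^esub> x"
      using y by (auto simp: a_r_coset_def')
    have "n \<in> carrier M"
      using n N.a_subset by auto
    hence "r \<odot>\<^bsub>M\<^esub> y = r \<odot>\<^bsub>M\<^esub> n \<oplus>\<^bsub>M\<^esub> r \<odot>\<^bsub>M\<^esub> x"
      using n r x by (simp add: smult_r_distr)
    moreover have "r \<odot>\<^bsub>M\<^esub> n \<in> N"
      using N r n by (simp add: submodule.smult_closed)
    ultimately have "r \<odot>\<^bsub>M\<^esub> y \<in> N +>\<^bsub>M\<^esub> (r \<odot>\<^bsub>M\<^esub> x)"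
      by (auto simp: a_r_coset_def')
    thus ?thesis
      using a_repr_independence[OF _ _ N.a_subgroup] r x by auto
  qed
  have "x \<in> N +>\<^bsub>M\<^esub> x"
    using x by (rule N.a_rcos_self)
  hence "(\<Union>y \<in> N +>\<^bsub>M\<^esub> x. N +>\<^bsub>M\<^esub> (r \<odot>\<^bsub>M\<^esub> y)) = N +>\<^bsub>M\<^esub> (r \<odot>\<^bsub>M\<^esub> x)"
    using eq by blast
  thus ?thesis
    by (simp add: quot_module_def)
qed

lemma (in module) quot_module_is_module:
  fixes N
  assumes N: "submodule N R M"
  shows "module R (quot_module M N)"
proof -
  interpret N: abelian_subgroup N M
    by (rule abelian_subgroup_submodule[OF N])
  have car: "carrier (quot_module M N) = {N +>\<^bsub>M\<^esub> x | x. x \<in> carrier M}"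
    by (auto simp: quot_module_def A_RCOSETS_def RCOSETS_def a_r_coset_def)
  have add: "(N +>\<^bsub>M\<^esub> x) \<oplus>\<^bsub>quot_module M N\<^esub> (N +>\<^bsub>M\<^esub> y) = N +>\<^bsub>M\<^esub> (x \<oplus>\<^bsub>M\<^esub> y)"
    if "x \<in> carrier M" "y \<in> carrier M" for x y
    using that by (simp add: quot_module_def N.a_rcos_sum)
  have zero: "\<zero>\<^bsub>quot_module M N\<^esub> = N +>\<^bsub>M\<^esub> \<zero>\<^bsub>M\<^esub>"
    using N.a_subset by (simp add: quot_module_def)
  have grp: "abelian_group (quot_module M N)"
  proof (rule abelian_groupI)
    fix x assume "x \<in> carrier (quot_module M N)"
    then obtain a where a: "x = N +>\<^bsub>M\<^esub> a" "a \<in> carrier M"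
      by (auto simp: car)
    have "(N +>\<^bsub>M\<^esub> \<ominus>\<^bsub>M\<^esub> a) \<oplus>\<^bsub>quot_module M N\<^esub> x = \<zero>\<^bsub>quot_module M N\<^esub>"
      using a by (simp add: add zero M.l_neg)
    moreover have "N +>\<^bsub>M\<^esub> \<ominus>\<^bsub>M\<^esub> a \<in> carrier (quot_module M N)"
      using a by (auto simp: car)
    ultimately show "\<exists>y \<in> carrier (quot_module M N).
        y \<oplus>\<^bsub>quot_module M N\<^esub> x = \<zero>\<^bsub>quot_module M N\<^esub>"
      by blast
    show "\<zero>\<^bsub>quot_module M N\<^esub> \<oplus>\<^bsub>quot_module M N\<^esub> x = x"
      using a by (simp add: add zero)
  next
    show "\<zero>\<^bsub>quot_module M N\<^esub> \<in> carrier (quot_module M N)"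
      by (auto simp: car zero)
  qed (auto simp: car add M.a_ac)
  note smult = quot_smult[OF N]
  show ?thesis
  proof (rule moduleI[OF R.is_cring grp])
    fix r x assume r: "r \<in> carrier R" and "x \<in> carrier (quot_module M N)"
    then obtain a where a: "x = N +>\<^bsub>M\<^esub> a" "a \<in> carrier M"
      by (auto simp: car)
    have "N +>\<^bsub>M\<^esub> (r \<odot>\<^bsub>M\<^esub> a) \<in> carrier (quot_module M N)"
      unfolding car using r a(2) by blast
    thus "r \<odot>\<^bsub>quot_module M N\<^esub> x \<in> carrier (quot_module M N)"
      using r a by (simp only: smult)
    fix q assume q: "q \<in> carrier R"
    show "(r \<oplus> q) \<odot>\<^bsub>quot_module M N\<^esub> x =
        r \<odot>\<^bsub>quot_module M N\<^esub> x \<oplus>\<^bsub>quot_module M N\<^esub> q \<odot>\<^bsub>quot_module M N\<^esub> x"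
      using r q a by (simp add: smult add smult_l_distr)
    show "r \<otimes> q \<odot>\<^bsub>quot_module M N\<^esub> x = r \<odot>\<^bsub>quot_module M N\<^esub> (q \<odot>\<^bsub>quot_module M N\<^esub> x)"
      using r q a by (simp add: smult smult_assoc1)
  next
    fix r x y
    assume r: "r \<in> carrier R" and "x \<in> carrier (quot_module M N)" "y \<in> carrier (quot_module M N)"
    then obtain a b where "x = N +>\<^bsub>M\<^esub> a" "a \<in> carrier M" "y = N +>\<^bsub>M\<^esub> b" "b \<in> carrier M"
      by (auto simp: car)
    thus "r \<odot>\<^bsub>quot_module M N\<^esub> (x \<oplus>\<^bsub>quot_module M N\<^esub> y) =
        r \<odot>\<^bsub>quot_module M N\<^esub> x \<oplus>\<^bsub>quot_module M N\<^esub> r \<odot>\<^bsub>quot_module M N\<^esub> y"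
      using r by (simp add: smult add smult_r_distr)
  next
    fix x assume "x \<in> carrier (quot_module M N)"
    thus "\<one> \<odot>\<^bsub>quot_module M N\<^esub> x = x"
      by (auto simp: car smult)
  qed
qed

lemma (in cring) ideal_quot_is_module:
  assumes K: "ideal K R" and J: "ideal J R" and "K \<subseteq> J"
  shows "module R (ideal_quot R J K)"
proof -
  interpret S: module R "self_module R"
    by (rule self_module_is_module)
  have sub: "submodule I R (self_module R)" if "ideal I R" for I
  proof -
    interpret I: ideal I R by fact
    have "subgroup I (add_monoid (self_module R)) = subgroup I (add_monoid R)"
      unfolding self_module_def subgroup_def m_inv_def
      by (simp only: partial_object.simps monoid.simps ring.simps)
    hence "subgroup I (add_monoid (self_module R))"
      using I.a_subgroup by blast
    moreover have "submodule_axioms I R (self_module R)"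
      unfolding submodule_axioms_def self_module_def using I.I_l_closed by simp
    ultimately show ?thesis
      by (rule submodule.intro)
  qed
  interpret J: module R "(self_module R)\<lparr>carrier := J\<rparr>"
    by (rule submodule.submodule_is_module[OF sub[OF J] self_module_is_module])
  have "module R ((self_module R)\<lparr>carrier := K\<rparr>)"
    by (rule submodule.submodule_is_module[OF sub[OF K] self_module_is_module])
  hence "submodule K R ((self_module R)\<lparr>carrier := J\<rparr>)"
    using J.module_incl_imp_submodule[of K] \<open>K \<subseteq> J\<close> by simp
  thus ?thesis
    unfolding ideal_quot_def by (rule J.quot_module_is_module)
qed

lemma (in cring) symbolic_power_ideal:
  assumes I: "ideal I R"
  shows "ideal (symbolic_power R I t) R" and "ideal_power R I t \<subseteq> symbolic_power R I t"
proof -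
  let ?A = "Ass R (ideal_quot R (carrier R) I)" and ?J = "ideal_power R I t"
  interpret J: ideal ?J R
    by (rule ideal_power_ideal[OF I])
  have P: "ideal {r \<in> carrier R. to_loc_at R P r \<in> ext_loc_at R P ?J} R"
    "?J \<subseteq> {r \<in> carrier R. to_loc_at R P r \<in> ext_loc_at R P ?J}" if "P \<in> ?A" for P
  proof -
    interpret P: primeideal P R
      using that by (simp add: Ass_def)
    interpret L: cring "loc_at R P"
      by (rule P.loc_at_cring)
    interpret h: ring_hom_ring R "loc_at R P" "to_loc_at R P"
      by (rule ring_hom_ringI2) (auto intro: ring_axioms L.ring_axioms P.to_loc_at_hom)
    have sub: "to_loc_at R P ` ?J \<subseteq> carrier (loc_at R P)"
      using J.a_subset by auto
    have "ideal (ext_loc_at R P ?J) (loc_at R P)"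
      unfolding ext_loc_at_def by (rule L.genideal_ideal[OF sub])
    thus "ideal {r \<in> carrier R. to_loc_at R P r \<in> ext_loc_at R P ?J} R"
      by (rule h.ideal_vimage)
    show "?J \<subseteq> {r \<in> carrier R. to_loc_at R P r \<in> ext_loc_at R P ?J}"
      using L.genideal_self[OF sub] J.a_subset unfolding ext_loc_at_def by blast
  qed
  have eq: "symbolic_power R I t =
      \<Inter> (insert (carrier R) ((\<lambda>P. {r \<in> carrier R. to_loc_at R P r \<in> ext_loc_at R P ?J}) ` ?A))"
    by (auto simp: symbolic_power_def)
  show "ideal (symbolic_power R I t) R"
    unfolding eq by (rule i_Intersect) (use P oneideal in auto)
  show "?J \<subseteq> symbolic_power R I t"
    unfolding eq using P J.a_subset by blast
qed

lemma (in cring) discrepancy_module_is_module: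
  "ideal I R \<Longrightarrow> module R (discrepancy_module R I t)"
  unfolding discrepancy_module_def
  by (intro ideal_quot_is_module ideal_power_ideal symbolic_power_ideal)

end

theory Submission
  imports Defs
begin

text \<open>
  An associated prime of \<open>R/J\<close> is a prime colon ideal \<open>(J : x)\<close>. The key fact for Noetherian \<open>R\<close> is
  that every prime containing some \<open>(J : x)\<close> contains a prime of the form \<open>(J : x y)\<close>; hence minimal
  primes of \<open>J\<close> are associated, and \<open>J'/J\<close> has an associated prime unless \<open>J' = J\<close>.

  For \<open>J = I\<^sup>t\<close>, an element \<open>x\<close> lies in the symbolic power iff \<open>(J : x)\<close> is contained in no
  \<open>Q \<in> Ass(R/I) = Min(I)\<close>. When \<open>(J : x)\<close> is a prime, it contains \<open>I\<close>, so by minimality of \<open>Q\<close> this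
  says that \<open>(J : x)\<close> is not itself a minimal prime of \<open>I\<close>, which is part (2). Part (1) is
  the case where both sides of (2) are empty, as \<open>Min(I) = Min(I\<^sup>t) \<subseteq> Ass(R/I\<^sup>t)\<close>.
\<close>

section \<open>Colon ideals and associated primes of quotients\<close>

definition colon :: "('a, 'b) ring_scheme \<Rightarrow> 'a set \<Rightarrow> 'a \<Rightarrow> 'a set" where
  "colon R J x = {r \<in> carrier R. r \<otimes>\<^bsub>R\<^esub> x \<in> J}"

context cring
begin

lemma colon_ideal:
  assumes "ideal J R" and x: "x \<in> carrier R"
  shows "ideal (colon R J x) R"
proof -
  interpret J: ideal J R by fact
  show ?thesis
  proof (rule idealI)
    show "ring R" by (rule ring_axioms)
    show "subgroup (colon R J x) (add_monoid R)"
    proof (rule add.subgroupI)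
      show "colon R J x \<noteq> {}"
        using x by (auto simp: colon_def intro!: exI[of _ \<zero>])
    qed (use x in \<open>auto simp: colon_def l_distr l_minus\<close>)
    show "y \<otimes> a \<in> colon R J x" if "a \<in> colon R J x" "y \<in> carrier R" for a y
      using that x J.I_l_closed by (auto simp: colon_def m_assoc)
    thus "a \<otimes> y \<in> colon R J x" if "a \<in> colon R J x" "y \<in> carrier R" for a y
      using that by (auto simp: colon_def m_comm)
  qed
qed

lemma subset_colon:
  assumes "ideal J R" "x \<in> carrier R"
  shows "J \<subseteq> colon R J x"
proof -
  interpret J: ideal J R by fact
  show ?thesis
    using assms(2) J.I_r_closed by (auto simp: colon_def)
qed

lemma colon_mult_mono:
  assumes "ideal J R" "x \<in> carrier R" "y \<in> carrier R"
  shows "colon R J x \<subseteq> colon R J (x \<otimes> y)"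
proof -
  interpret J: ideal J R by fact
  show ?thesis
    using assms(2,3) J.I_r_closed by (auto simp: colon_def m_assoc[symmetric])
qed

lemma colon_one:
  assumes "ideal J R"
  shows "colon R J \<one> = J"
proof -
  interpret J: ideal J R by fact
  show ?thesis
    by (auto simp: colon_def)
qed

text \<open>A scalar \<open>r\<close> kills the coset of \<open>x\<close> exactly when
  \<open>r \<otimes> x\<close> lies in \<open>K\<close>, so annihilators of cosets are colon ideals.
  From here on the argument works with elements of \<open>R\<close> instead of cosets.\<close>

lemma Ass_ideal_quot:
  assumes K: "ideal K R" and J: "ideal J R" and "K \<subseteq> J"
  shows "Ass R (ideal_quot R J K) = {P. primeideal P R \<and> (\<exists>x \<in> J. P = colon R K x)}"
proof -
  interpret K: ideal K R by (rule K)
  interpret J: ideal J R by (rule J)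
  let ?M = "(self_module R)\<lparr>carrier := J\<rparr>"
  have coset: "K +>\<^bsub>?M\<^esub> x = K +> x" for x
    by (simp add: a_r_coset_def' self_module_def)
  have car: "carrier (ideal_quot R J K) = {K +> x | x. x \<in> J}"
    unfolding ideal_quot_def quot_module_def partial_object.simps A_RCOSETS_def'
    by (auto simp: a_r_coset_def' self_module_def)
  have smult: "r \<odot>\<^bsub>ideal_quot R J K\<^esub> (K +> x) = K +> (r \<otimes> x)"
    if r: "r \<in> carrier R" and x: "x \<in> carrier R" for r x
  proof -
    \<comment> \<open>The action on cosets is a union over representatives \<open>y\<close>; it
      collapses to one coset because \<open>K\<close> absorbs multiples of its elements.\<close>
    have "K +> (r \<otimes> y) = K +> (r \<otimes> x)" if y: "y \<in> K +> x" for y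
    proof -
      obtain k where k: "k \<in> K" "y = k \<oplus> x"
        using y by (auto simp: a_r_coset_def')
      have "r \<otimes> y = r \<otimes> k \<oplus> r \<otimes> x"
        using k r x by (simp add: r_distr)
      hence "r \<otimes> y \<in> K +> (r \<otimes> x)"
        using K.I_l_closed[OF k(1) r] by (auto simp: a_r_coset_def')
      thus ?thesis
        using a_repr_independence[OF _ _ K.a_subgroup] r x by auto
    qed
    moreover have "x \<in> K +> x"
      using x by (rule K.a_rcos_self)
    ultimately have "(\<Union>y \<in> K +> x. K +> (r \<otimes> y)) = K +> (r \<otimes> x)"
      by blast
    thus ?thesis
      by (simp add: ideal_quot_def quot_module_def coset) (simp add: self_module_def)
  qed
  have "annihilator R (ideal_quot R J K) (K +> x) = colon R K x" if "x \<in> J" for x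
  proof -
    have x: "x \<in> carrier R"
      using that by simp
    have "K +> (r \<otimes> x) = K \<longleftrightarrow> r \<otimes> x \<in> K" if "r \<in> carrier R" for r
      using that x a_coset_join1[OF _ _ K.a_subgroup] K.a_rcos_const by blast
    moreover have "\<zero>\<^bsub>ideal_quot R J K\<^esub> = K"
      by (simp add: ideal_quot_def quot_module_def)
    ultimately show ?thesis
      using x by (simp add: annihilator_def colon_def smult cong: conj_cong)
  qed
  thus ?thesis
    by (auto simp: Ass_def car)
qed

section \<open>Contraction of ideals from a localization\<close>

text \<open>Every element of the extension is a single fraction \<open>a / s\<close> with
  \<open>a \<in> J\<close>, and \<open>r / 1 = a / s\<close> says that some element outside
  \<open>P\<close> multiplies \<open>r\<close> into \<open>J\<close>.\<close>

lemma to_loc_at_mem_ext_iff: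
  assumes P: "primeideal P R" and J: "ideal J R" and r: "r \<in> carrier R"
  shows "to_loc_at R P r \<in> ext_loc_at R P J \<longleftrightarrow> \<not> colon R J r \<subseteq> P"
proof -
  interpret P: primeideal P R by (rule P)
  interpret J: ideal J R by (rule J)
  let ?S = "carrier R - P" and ?L = "loc_at R P"
  interpret F: cring_frac R ?S
    by (rule P.cring_frac_compl)
  interpret L: cring ?L
    by (rule P.loc_at_cring)
  have sub: "to_loc_at R P ` J \<subseteq> carrier ?L"
    using F.one_closed by (auto simp: to_loc_at_def loc_at_def intro!: F.frac_closed)
  show ?thesis
  proof
    \<comment> \<open>The extension is the smallest ideal containing the image of \<open>J\<close>.
      It lies in \<open>?E\<close> once \<open>?E\<close> is known to be an ideal containing that
      image.\<close>
    let ?E = "{fraction R ?S a s | a s. a \<in> J \<and> s \<in> ?S}"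
    have "ideal ?E ?L"
    proof (rule idealI)
      show "ring ?L" by (rule L.ring_axioms)
      have neg: "\<ominus>\<^bsub>?L\<^esub> fraction R ?S a s = fraction R ?S (\<ominus> a) s" if "a \<in> J" "s \<in> ?S" for a s
      proof (rule L.minus_equality)
        have "s \<otimes> \<ominus> a \<oplus> s \<otimes> a = \<zero>"
          using that by (simp add: r_distr[symmetric] l_neg)
        moreover have "fraction R ?S \<zero> (s \<otimes> s) = fraction R ?S \<zero> \<one>"
          using that F.one_closed F.m_closed[of s s] by (intro F.frac_eqI) auto
        ultimately show "fraction R ?S (\<ominus> a) s \<oplus>\<^bsub>?L\<^esub> fraction R ?S a s = \<zero>\<^bsub>?L\<^esub>"
          unfolding loc_at_def using that by (simp add: F.frac_add F.loc_zero del: Diff_iff)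
      qed (use that in \<open>auto simp: loc_at_def intro!: F.frac_closed\<close>)
      show "subgroup ?E (add_monoid ?L)"
      proof (rule L.add.subgroupI)
        show "?E \<subseteq> carrier ?L"
          by (auto simp: loc_at_def intro!: F.frac_closed)
        show "?E \<noteq> {}"
          using J.zero_closed F.one_closed by blast
        fix x assume "x \<in> ?E"
        then obtain a s where a: "x = fraction R ?S a s" "a \<in> J" "s \<in> ?S"
          by blast
        show "\<ominus>\<^bsub>?L\<^esub> x \<in> ?E"
          using neg[of a s] a by auto
        fix y assume "y \<in> ?E"
        then obtain b w where b: "y = fraction R ?S b w" "b \<in> J" "w \<in> ?S"
          by blast
        have "x \<oplus>\<^bsub>?L\<^esub> y = fraction R ?S (w \<otimes> a \<oplus> s \<otimes> b) (s \<otimes> w)"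
          unfolding a(1) b(1) loc_at_def using a b by (intro F.frac_add) auto
        moreover have "w \<otimes> a \<oplus> s \<otimes> b \<in> J"
          using a b J.I_l_closed by auto
        moreover have "s \<otimes> w \<in> ?S"
          using a(3) b(3) by (rule F.m_closed)
        ultimately show "x \<oplus>\<^bsub>?L\<^esub> y \<in> ?E"
          by blast
      qed
      show l_closed: "y \<otimes>\<^bsub>?L\<^esub> x \<in> ?E" if x: "x \<in> ?E" and y: "y \<in> carrier ?L" for x y
      proof -
        obtain a s where a: "x = fraction R ?S a s" "a \<in> J" "s \<in> ?S"
          using x by blast
        obtain b w where b: "y = fraction R ?S b w" "b \<in> carrier R" "w \<in> ?S"
          using y unfolding loc_at_def by (rule F.loc_cases)
        have "y \<otimes>\<^bsub>?L\<^esub> x = fraction R ?S (b \<otimes> a) (w \<otimes> s)"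
          unfolding a(1) b(1) loc_at_def using a b by (intro F.frac_mult) auto
        moreover have "b \<otimes> a \<in> J"
          using a b J.I_l_closed by auto
        moreover have "w \<otimes> s \<in> ?S"
          using b(3) a(3) by (rule F.m_closed)
        ultimately show ?thesis
          by blast
      qed
      show "x \<otimes>\<^bsub>?L\<^esub> y \<in> ?E" if "x \<in> ?E" "y \<in> carrier ?L" for x y
      proof -
        have "x \<in> carrier ?L"
          using that(1) by (auto simp: loc_at_def intro!: F.frac_closed)
        hence "x \<otimes>\<^bsub>?L\<^esub> y = y \<otimes>\<^bsub>?L\<^esub> x"
          using that(2) by (rule L.m_comm)
        thus ?thesis
          using l_closed[OF that] by (simp only:)
      qed
    qed
    moreover have "to_loc_at R P ` J \<subseteq> ?E"
      using F.one_closed by (auto simp: to_loc_at_def)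
    ultimately have ext: "ext_loc_at R P J \<subseteq> ?E"
      unfolding ext_loc_at_def by (rule L.genideal_minimal)
    assume "to_loc_at R P r \<in> ext_loc_at R P J"
    then obtain a s where a: "fraction R ?S r \<one> = fraction R ?S a s" "a \<in> J" "s \<in> ?S"
      using ext unfolding to_loc_at_def by blast
    \<comment> \<open>Equality of fractions holds only up to a factor \<open>u\<close> outside
      \<open>P\<close>, so the multiplier taken is \<open>u \<otimes> s\<close>; it avoids
      \<open>P\<close> because \<open>P\<close> is prime.\<close>
    then obtain u where u: "u \<in> ?S" "u \<otimes> (s \<otimes> r) = u \<otimes> (\<one> \<otimes> a)"
      using r F.frac_eq_iff[of r \<one> a s] F.one_closed by auto
    have "(u \<otimes> s) \<otimes> r \<in> J"
      using u a r J.I_l_closed by (auto simp: m_assoc)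
    moreover have "u \<otimes> s \<in> ?S"
      using u(1) a(3) by (rule F.m_closed)
    ultimately show "\<not> colon R J r \<subseteq> P"
      by (auto simp: colon_def)
  next
    assume "\<not> colon R J r \<subseteq> P"
    then obtain s where s: "s \<in> ?S" "s \<otimes> r \<in> J"
      by (auto simp: colon_def)
    interpret E: ideal "ext_loc_at R P J" ?L
      unfolding ext_loc_at_def by (rule L.genideal_ideal[OF sub])
    have "to_loc_at R P (s \<otimes> r) \<in> ext_loc_at R P J"
      using L.genideal_self[OF sub] s(2) unfolding ext_loc_at_def by blast
    \<comment> \<open>Since \<open>s\<close> lies outside \<open>P\<close>, multiplying by
      \<open>1 / s\<close> recovers \<open>r / 1\<close> from
      \<open>(s \<otimes> r) / 1\<close>.\<close>
    hence "fraction R ?S \<one> s \<otimes>\<^bsub>?L\<^esub> to_loc_at R P (s \<otimes> r) \<in> ext_loc_at R P J"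
      using s(1) by (intro E.I_l_closed) (auto simp: loc_at_def intro!: F.frac_closed)
    also have "fraction R ?S \<one> s \<otimes>\<^bsub>?L\<^esub> to_loc_at R P (s \<otimes> r)
        = fraction R ?S (\<one> \<otimes> (s \<otimes> r)) (s \<otimes> \<one>)"
      unfolding loc_at_def to_loc_at_def using s r F.one_closed by (intro F.frac_mult) auto
    also have "\<dots> = to_loc_at R P r"
      unfolding to_loc_at_def using s r F.one_closed by (intro F.frac_eqI) auto
    finally show "to_loc_at R P r \<in> ext_loc_at R P J" .
  qed
qed

section \<open>Primes above an ideal and above its powers\<close>

lemma primeideal_ideal_power_subset_iff:
  assumes P: "primeideal P R" and I: "ideal I R" and "t \<ge> 1"
  shows "ideal_power R I t \<subseteq> P \<longleftrightarrow> I \<subseteq> P"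
proof
  interpret P: primeideal P R by (rule P)
  interpret I: ideal I R by (rule I)
  show "I \<subseteq> P" if "ideal_power R I t \<subseteq> P"
    using that
  proof (induction t)
    \<comment> \<open>The zeroth power is the whole ring, so here the hypothesis already puts
      \<open>I\<close> inside \<open>P\<close>.\<close>
    case 0
    then show ?case
      using I.a_subset by (auto simp: ideal_power_0)
  next
    case (Suc t)
    show ?case
    proof (rule ccontr)
      assume "\<not> I \<subseteq> P"
      then obtain x where x: "x \<in> I" "x \<notin> P" by blast
      interpret J: ideal "ideal_power R I t" R
        by (rule ideal_power_ideal[OF I])
      \<comment> \<open>An element \<open>x\<close> of \<open>I\<close> outside \<open>P\<close> can
        be cancelled from the products \<open>y \<otimes> x\<close>, which lowers the exponent by
        one.\<close>
      have "ideal_power R I t \<subseteq> P"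
      proof
        fix y assume y: "y \<in> ideal_power R I t"
        hence "y \<otimes> x \<in> P"
          using Suc.prems x(1) by (auto simp: ideal_power_Suc intro: ideal_prod.prod)
        thus "y \<in> P"
          using x y P.I_prime[of y x] by auto
      qed
      with Suc.IH \<open>\<not> I \<subseteq> P\<close> show False by blast
    qed
  qed
  \<comment> \<open>A positive exponent leaves one factor \<open>I\<close> to split off, so the
    power lies in \<open>I\<close>.\<close>
  obtain n where "t = Suc n"
    using \<open>t \<ge> 1\<close> by (cases t) auto
  thus "ideal_power R I t \<subseteq> P" if "I \<subseteq> P"
    using that ideal_prod_inter[OF ideal_power_ideal[OF I, of n] I] by (auto simp: ideal_power_Suc)
qed

text \<open>This lets \<open>Emb\<close>, which removes the minimal primes of \<open>I\<close>, be
  read as the set of embedded primes of the power itself.\<close>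

lemma Min_primes_ideal_power:
  assumes "ideal I R" "t \<ge> 1"
  shows "Min_primes R (ideal_power R I t) = Min_primes R I"
  unfolding Min_primes_def
  by (simp add: primeideal_ideal_power_subset_iff[OF _ assms] cong: conj_cong)

end

section \<open>Existence of associated primes over Noetherian rings\<close>

text \<open>Zorn's lemma applies because a nonempty chain of ideals contains its own union. It
  serves both for colon ideals inside a prime and for proper ideals above a given one.\<close>

lemma (in noetherian_ring) ideal_family_has_maximal:
  assumes "A \<noteq> {}" and "\<And>J. J \<in> A \<Longrightarrow> ideal J R"
  obtains M where "M \<in> A" "\<And>J. J \<in> A \<Longrightarrow> M \<subseteq> J \<Longrightarrow> J = M"
proof -
  have "\<exists>M \<in> A. \<forall>J \<in> A. M \<subseteq> J \<longrightarrow> J = M"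
  proof (rule subset_Zorn)
    fix C assume C: "subset.chain A C"
    show "\<exists>U \<in> A. \<forall>J \<in> C. J \<subseteq> U"
    proof (cases "C = {}")
      case False
      have "subset.chain {J. ideal J R} C"
        using C assms(2) by (auto simp: subset.chain_def)
      hence "\<Union>C \<in> C"
        using False by (rule ideal_chain_is_trivial[rotated])
      thus ?thesis
        using C by (auto simp: subset.chain_def)
    qed (use assms(1) in auto)
  qed
  thus ?thesis
    using that by blast
qed

locale noetherian_cring = cring R + noetherian_ring R for R (structure)
begin

text \<open>
  Take \<open>(J : x y) \<subseteq> P\<close> maximal. If \<open>a b \<in> (J : x y)\<close> and \<open>a \<notin> (J : x y)\<close>, maximality shows
  that \<open>(J : x y b)\<close> equals \<open>(J : x y)\<close> or is not contained in \<open>P\<close>. The former contradicts the choice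
  of \<open>a\<close>; in the latter case some \<open>s \<notin> P\<close> has \<open>b \<in> (J : x y s)\<close>, which equals \<open>(J : x y)\<close> by maximality.
\<close>
lemma prime_colon_below:
  assumes J: "ideal J R" and P: "primeideal P R" and x: "x \<in> carrier R" and "colon R J x \<subseteq> P"
  obtains y where "y \<in> carrier R" "primeideal (colon R J (x \<otimes> y)) R" "colon R J (x \<otimes> y) \<subseteq> P"
proof -
  interpret P: primeideal P R by (rule P)
  define A where "A = {colon R J (x \<otimes> y) | y. y \<in> carrier R \<and> colon R J (x \<otimes> y) \<subseteq> P}"
  have "colon R J (x \<otimes> \<one>) \<in> A"
    unfolding A_def using assms(4) x by (intro CollectI exI[of _ \<one>]) simp
  moreover have "ideal Q R" if "Q \<in> A" for Q
    using that x colon_ideal[OF J] unfolding A_def by auto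
  ultimately obtain Q where Q: "Q \<in> A" and max: "\<And>Q'. Q' \<in> A \<Longrightarrow> Q \<subseteq> Q' \<Longrightarrow> Q' = Q"
    using ideal_family_has_maximal[of A] by blast
  obtain y where y: "y \<in> carrier R" "Q = colon R J (x \<otimes> y)" "Q \<subseteq> P"
    using Q unfolding A_def by blast
  define z where "z = x \<otimes> y"
  have z: "z \<in> carrier R" "Q = colon R J z"
    using x y by (auto simp: z_def)
  have eq: "colon R J (z \<otimes> s) = Q" if s: "s \<in> carrier R" "colon R J (z \<otimes> s) \<subseteq> P" for s
  proof (rule max)
    have "z \<otimes> s = x \<otimes> (y \<otimes> s)"
      using x y s by (simp add: z_def m_assoc)
    thus "colon R J (z \<otimes> s) \<in> A"
      using s y unfolding A_def by force
    show "Q \<subseteq> colon R J (z \<otimes> s)"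
      unfolding z(2) by (rule colon_mult_mono[OF J z(1) s(1)])
  qed
  have "primeideal Q R"
  proof (rule primeidealI)
    show "ideal Q R"
      unfolding z(2) by (rule colon_ideal[OF J z(1)])
    show "cring R" by (rule is_cring)
    show "carrier R \<noteq> Q"
      using y(3) P.I_notcarr P.a_subset by blast
    fix a b assume a: "a \<in> carrier R" and b: "b \<in> carrier R" and ab: "a \<otimes> b \<in> Q"
    show "a \<in> Q \<or> b \<in> Q"
    proof (cases "colon R J (z \<otimes> b) \<subseteq> P")
      case True
      have "a \<in> colon R J (z \<otimes> b)"
        using a b ab z by (auto simp: colon_def m_ac)
      thus ?thesis
        using eq[OF b True] by blast
    next
      case False
      then obtain s where s: "s \<in> carrier R" "s \<notin> P" "s \<otimes> (z \<otimes> b) \<in> J"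
        by (auto simp: colon_def)
      have "colon R J (z \<otimes> s) \<subseteq> P"
      proof
        fix u assume "u \<in> colon R J (z \<otimes> s)"
        hence u: "u \<in> carrier R" "u \<otimes> s \<in> Q"
          using s z by (auto simp: colon_def m_ac)
        show "u \<in> P"
          using u s y(3) P.I_prime[of u s] by auto
      qed
      moreover have "b \<in> colon R J (z \<otimes> s)"
        using b s z by (auto simp: colon_def m_ac)
      ultimately show ?thesis
        using eq[OF s(1)] by blast
    qed
  qed
  thus ?thesis
    using that[of y] y by auto
qed

lemma ex_primeideal_above:
  assumes "ideal J R" "J \<noteq> carrier R"
  obtains P where "primeideal P R" "J \<subseteq> P"
proof -
  let ?A = "{K. ideal K R \<and> J \<subseteq> K \<and> K \<noteq> carrier R}"
  obtain M where M: "M \<in> ?A" "\<And>K. K \<in> ?A \<Longrightarrow> M \<subseteq> K \<Longrightarrow> K = M"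
    by (rule ideal_family_has_maximal[of ?A]) (use assms in auto)
  have "maximalideal M R"
    by (rule maximalidealI) (use M in blast)+
  thus ?thesis
    using M that maximalideal_prime by blast
qed

text \<open>As \<open>(J : 1) = J\<close>, a minimal prime \<open>P\<close> of \<open>J\<close>
  contains a prime \<open>(J : y)\<close>. This also contains \<open>J\<close>, so minimality makes
  it equal to \<open>P\<close>.\<close>

lemma Min_primes_subset_Ass:
  assumes J: "ideal J R"
  shows "Min_primes R J \<subseteq> Ass R (ideal_quot R (carrier R) J)"
proof
  interpret J: ideal J R by (rule J)
  fix P assume P: "P \<in> Min_primes R J"
  hence "primeideal P R" "colon R J \<one> \<subseteq> P"
    by (auto simp: Min_primes_def colon_one[OF J])
  then obtain y where y: "y \<in> carrier R" "primeideal (colon R J y) R" "colon R J y \<subseteq> P"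
    by (rule prime_colon_below[OF J _ one_closed]) simp
  hence "colon R J y = P"
    using P subset_colon[OF J y(1)] unfolding Min_primes_def by blast
  thus "P \<in> Ass R (ideal_quot R (carrier R) J)"
    using y unfolding Ass_ideal_quot[OF J oneideal J.a_subset] by auto
qed

text \<open>For \<open>x\<close> in \<open>J\<close> outside \<open>K\<close>, the proper ideal
  \<open>(K : x)\<close> lies in some prime, hence some \<open>(K : x y)\<close> is prime, and
  \<open>x y\<close> is still in \<open>J\<close>. If \<open>K = J\<close>, all the colon ideals in
  question are the whole ring.\<close>

lemma Ass_ideal_quot_eq_empty_iff:
  assumes K: "ideal K R" and J: "ideal J R" and "K \<subseteq> J"
  shows "Ass R (ideal_quot R J K) = {} \<longleftrightarrow> K = J"
proof
  interpret K: ideal K R by (rule K)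
  interpret J: ideal J R by (rule J)
  note Ass = Ass_ideal_quot[OF assms]
  show "K = J" if empty: "Ass R (ideal_quot R J K) = {}"
  proof (rule ccontr)
    assume "K \<noteq> J"
    then obtain x where x: "x \<in> J" "x \<notin> K"
      using \<open>K \<subseteq> J\<close> by blast
    hence "\<one> \<notin> colon R K x"
      by (simp add: colon_def)
    hence "colon R K x \<noteq> carrier R"
      using one_closed by blast
    then obtain P where P: "primeideal P R" "colon R K x \<subseteq> P"
      using ex_primeideal_above[OF colon_ideal[OF K J.Icarr[OF x(1)]]] by blast
    obtain y where "y \<in> carrier R" "primeideal (colon R K (x \<otimes> y)) R"
      by (rule prime_colon_below[OF K P(1) J.Icarr[OF x(1)] P(2)])
    thus False
      using empty x(1) J.I_r_closed unfolding Ass by blast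
  qed
  have "colon R K x = carrier R" if "x \<in> K" for x
    using that K.I_l_closed by (auto simp: colon_def)
  thus "Ass R (ideal_quot R J K) = {}" if "K = J"
    unfolding Ass using that primeideal.I_notcarr by blast
qed

section \<open>Symbolic powers and the discrepancy module\<close>

lemma symbolic_power_eq:
  assumes "ideal I R"
  shows "symbolic_power R I t = {x \<in> carrier R. \<forall>P \<in> Ass R (ideal_quot R (carrier R) I).
    \<not> colon R (ideal_power R I t) x \<subseteq> P}"
  unfolding symbolic_power_def
  by (intro Collect_cong conj_cong ball_cong refl to_loc_at_mem_ext_iff ideal_power_ideal assms)
    (auto simp: Ass_def)

lemma Ass_discrepancy_module:
  assumes I: "ideal I R" and emb: "no_embedded_primes R I" and t: "t \<ge> 1"
  shows "Ass R (discrepancy_module R I t) = Emb R I t"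
proof -
  let ?J = "ideal_power R I t" and ?S = "symbolic_power R I t"
  have J: "ideal ?J R"
    by (rule ideal_power_ideal[OF I])
  note S = symbolic_power_ideal[OF I, of t]
  interpret J: ideal ?J R by (rule J)
  \<comment> \<open>The left side restricts \<open>x\<close> to the symbolic power, the right side
    discards minimal primes of \<open>I\<close>; for prime colon ideals these are the same
    condition.\<close>
  have mem_S: "x \<in> ?S \<longleftrightarrow> colon R ?J x \<notin> Min_primes R I"
    if x: "x \<in> carrier R" and prime: "primeideal (colon R ?J x) R" for x
  proof -
    have I_sub: "I \<subseteq> colon R ?J x"
      using primeideal_ideal_power_subset_iff[OF prime I t] subset_colon[OF J x] by blast
    \<comment> \<open>Containment in a minimal prime forces equality, since the prime
      \<open>(J : x)\<close> contains \<open>I\<close>.\<close>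
    have "colon R ?J x = P" if "P \<in> Min_primes R I" "colon R ?J x \<subseteq> P" for P
      using that prime I_sub unfolding Min_primes_def by blast
    thus ?thesis
      using x emb unfolding symbolic_power_eq[OF I] no_embedded_primes_def by blast
  qed
  have "?S \<subseteq> carrier R"
    by (auto simp: symbolic_power_def)
  thus ?thesis
    unfolding discrepancy_module_def Emb_def Ass_ideal_quot[OF J S]
      Ass_ideal_quot[OF J oneideal J.a_subset]
    using mem_S by blast
qed

end

theorem theorem2p1:
  fixes R :: "('a, 'b) ring_scheme" and I :: "'a set" and t :: nat
  assumes "cring R" and "noetherian_ring R"
    and "ideal I R" and "I \<noteq> carrier R"
    and "no_embedded_primes R I"
    and "t \<ge> 1"
  shows "(ideal_power R I t = symbolic_power R I t \<longleftrightarrow> no_embedded_primes R (ideal_power R I t))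
    \<and> Ass R (discrepancy_module R I t) = Emb R I t"
proof -
  interpret noetherian_cring R
    using assms(1,2) by (rule noetherian_cring.intro)
  let ?J = "ideal_power R I t"
  have J: "ideal ?J R"
    by (rule ideal_power_ideal[OF assms(3)])
  have Ass: "Ass R (discrepancy_module R I t) = Emb R I t"
    by (rule Ass_discrepancy_module[OF assms(3,5,6)])
  have "?J = symbolic_power R I t \<longleftrightarrow> Emb R I t = {}"
    using Ass_ideal_quot_eq_empty_iff[OF J symbolic_power_ideal[OF assms(3)]] Ass
    by (simp add: discrepancy_module_def)
  \<comment> \<open>Minimal primes of the power are always associated, so an empty difference
    already means equality of the two sets.\<close>
  also have "\<dots> \<longleftrightarrow> no_embedded_primes R ?J"
    using Min_primes_subset_Ass[OF J] Min_primes_ideal_power[OF assms(3,6)]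
    unfolding Emb_def no_embedded_primes_def by blast
  finally show ?thesis
    using Ass by blast
qed

end
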